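(* Let $f=f(u)$ and $\varphi=\varphi(u)$ be smooth real functions, and consider the rotational hypersurface in $\mathbb{E}^4$ $$\mathbf{x}(u,v,w)=\left(f(u)\cos v\cos w,\ f(u)\sin v\cos w,\ f(u)\sin w,\ \varphi(u)\right),$$ at points where $\mathbf{x}$ is an immersion. Put $W=f'^2+\varphi'^2$. Then its fourth fundamental form matrix is $$IV=\mathrm{diag}\left(-\frac{\left(f'\varphi''-f''\varphi'\right)^3}{W^{7/2}},\ -\frac{\varphi'^3}{fW^{3/2}}\cos^2w,\ -\frac{\varphi'^3}{fW^{3/2}}\right).$$
   Context: $\mathbb{E}^4$ is $\mathbb{R}^4$ with its standard inner product $\langle\cdot,\cdot\rangle$; primes denote $d/du$. The immersion condition amounts to $W>0$, $f\neq0$, $\cos w\neq 0$. The unit normal (Gauss map) used is $\mathbf{G}=W^{-1/2}\left(\varphi'\cos v\cos w,\ \varphi'\sin v\cos w,\ \varphi'\sin w,\ -f'\right)$. All matrices are taken in the coordinates $(u,v,w)$: $I$ is the Gram matrix of $(\mathbf{x}_u,\mathbf{x}_v,\mathbf{x}_w)$, $II$ is the matrix of inner products of the second partial derivatives of $\mathbf{x}$ with $\mathbf{G}$, the shape operator matrix is $\mathbf{S}=I^{-1}\cdot II$, and the third and fourth fundamental form matrices are $III=II\cdot\mathbf{S}$ and $IV=III\cdot\mathbf{S}$. *)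

theory Defs
  imports "HOL-Analysis.Analysis"
begin

(* Intended for open U, where the values of the iterated derivatives on U do not
   depend on f outside U. *)
definition smooth_on :: "real set \<Rightarrow> (real \<Rightarrow> real) \<Rightarrow> bool" where
  "smooth_on U f \<longleftrightarrow> (\<forall>n. \<forall>u\<in>U. ((deriv ^^ n) f) differentiable (at u))"

definition partial :: "'m::finite \<Rightarrow> (real^'m \<Rightarrow> real^'n) \<Rightarrow> real^'m \<Rightarrow> real^'n" where
  "partial i X p = vector_derivative (\<lambda>t. X (p + t *\<^sub>R axis i 1)) (at 0)"

definition immersion_at :: "(real^'m \<Rightarrow> real^'n) \<Rightarrow> real^'m \<Rightarrow> bool" where
  "immersion_at X p \<longleftrightarrow> (\<exists>D. (X has_derivative D) (at p) \<and> inj D)"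

definition diag_matrix :: "real^'n \<Rightarrow> real^'n^'n" where
  "diag_matrix d = (\<chi> i j. if i = j then d $ i else 0)"

definition first_form :: "(real^'m \<Rightarrow> real^'n) \<Rightarrow> real^'m \<Rightarrow> real^'m^'m" where
  "first_form X p = (\<chi> i j. partial i X p \<bullet> partial j X p)"

(* In the second to fourth forms, N is the chosen unit normal field along X. *)
definition second_form ::
    "(real^'m \<Rightarrow> real^'n) \<Rightarrow> (real^'m \<Rightarrow> real^'n) \<Rightarrow> real^'m \<Rightarrow> real^'m^'m" where
  "second_form X N p = (\<chi> i j. partial j (partial i X) p \<bullet> N p)"

definition shape_operator ::
    "(real^'m \<Rightarrow> real^'n) \<Rightarrow> (real^'m \<Rightarrow> real^'n) \<Rightarrow> real^'m \<Rightarrow> real^'m^'m" where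
  "shape_operator X N p = matrix_inv (first_form X p) ** second_form X N p"

definition third_form ::
    "(real^'m \<Rightarrow> real^'n) \<Rightarrow> (real^'m \<Rightarrow> real^'n) \<Rightarrow> real^'m \<Rightarrow> real^'m^'m" where
  "third_form X N p = second_form X N p ** shape_operator X N p"

definition fourth_form ::
    "(real^'m \<Rightarrow> real^'n) \<Rightarrow> (real^'m \<Rightarrow> real^'n) \<Rightarrow> real^'m \<Rightarrow> real^'m^'m" where
  "fourth_form X N p = third_form X N p ** shape_operator X N p"

(* The parameter point p has coordinates p $ 1 = u, p $ 2 = v, p $ 3 = w. *)
definition rot_hypersurface ::
    "(real \<Rightarrow> real) \<Rightarrow> (real \<Rightarrow> real) \<Rightarrow> real^3 \<Rightarrow> real^4" where
  "rot_hypersurface f \<phi> p =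
     (let u = p $ 1; v = p $ 2; w = p $ 3 in
      vector [f u * cos v * cos w, f u * sin v * cos w, f u * sin w, \<phi> u])"

definition speed_sq :: "(real \<Rightarrow> real) \<Rightarrow> (real \<Rightarrow> real) \<Rightarrow> real \<Rightarrow> real" where
  "speed_sq f \<phi> u = (deriv f u)\<^sup>2 + (deriv \<phi> u)\<^sup>2"

definition gauss_map ::
    "(real \<Rightarrow> real) \<Rightarrow> (real \<Rightarrow> real) \<Rightarrow> real^3 \<Rightarrow> real^4" where
  "gauss_map f \<phi> p =
     (let u = p $ 1; v = p $ 2; w = p $ 3 in
      speed_sq f \<phi> u powr (-1/2) *\<^sub>R
      vector [deriv \<phi> u * cos v * cos w, deriv \<phi> u * sin v * cos w,
              deriv \<phi> u * sin w, - deriv f u])"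

end

theory Submission
  imports Defs
begin

text \<open>In the coordinates \<open>(u, v, w)\<close> both \<open>I\<close> and \<open>II\<close> are diagonal: the parameter curves
  are lines of curvature. The immersion hypothesis makes the diagonal entries
  \<open>W\<close>, \<open>f\<^sup>2 cos\<^sup>2 w\<close>, \<open>f\<^sup>2\<close> of \<open>I\<close> nonzero, so \<open>IV = II I\<inverse> II I\<inverse> II\<close> is computed entrywise.\<close>

section \<open>Partial derivatives and what an immersion says about them\<close>

lemma partial_eqI:
  assumes "((\<lambda>t. X (p + t *\<^sub>R axis i 1)) has_vector_derivative D) (at 0)"
  shows "partial i X p = D"
  using assms by (simp add: partial_def vector_derivative_at)

text \<open>Second partials differentiate a function that is known in closed form only near the
  point. A coordinate line through \<open>p\<close> stays in \<open>S\<close> for small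
  \<open>t\<close>, and a derivative at 0 sees only those \<open>t\<close>.\<close>

lemma partial_cong:
  assumes "open S" "p \<in> S" "\<And>q. q \<in> S \<Longrightarrow> X q = Y q"
  shows "partial i X p = partial i Y p"
proof -
  have "((\<lambda>t. p + t *\<^sub>R axis i 1) \<longlongrightarrow> p + 0 *\<^sub>R axis i 1) (nhds (0::real))"
    by (intro tendsto_intros filterlim_ident)
  then have "\<forall>\<^sub>F t in nhds 0. p + t *\<^sub>R axis i 1 \<in> S"
    using assms(1,2) by (auto dest: topological_tendstoD)
  then have "\<forall>\<^sub>F t in nhds 0. X (p + t *\<^sub>R axis i 1) = Y (p + t *\<^sub>R axis i 1)"
    by eventually_elim (rule assms(3))
  then show ?thesis
    unfolding partial_def by (intro vector_derivative_cong_eq) auto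
qed

lemma has_derivative_partial:
  assumes "(X has_derivative D) (at p)"
  shows "D (axis i 1) = partial i X p"
proof -
  have "(X has_derivative D) (at (p + 0 *\<^sub>R axis i 1))"
    using assms by simp
  moreover have "((\<lambda>t. p + t *\<^sub>R axis i 1) has_derivative (\<lambda>t. t *\<^sub>R axis i 1)) (at 0)"
    by (auto intro!: derivative_eq_intros)
  ultimately have
    "((\<lambda>t. X (p + t *\<^sub>R axis i 1)) has_derivative (\<lambda>t. D (t *\<^sub>R axis i 1))) (at 0)"
    by (rule has_derivative_compose[rotated])
  moreover have "D (t *\<^sub>R axis i 1) = t *\<^sub>R D (axis i 1)" for t
    using assms by (simp add: has_derivative_def bounded_linear.linear linear_scale)
  ultimately show ?thesis
    by (intro partial_eqI[symmetric]) (simp add: has_vector_derivative_def)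
qed

text \<open>An injective linear map does not kill an axis vector. For the hypersurface the partials
  turn out to be mutually orthogonal, so their nonvanishing captures all that is needed of
  independence.\<close>

lemma immersion_at_partial_nonzero:
  assumes "immersion_at X p"
  shows "partial i X p \<noteq> 0"
proof -
  from assms obtain D where D: "(X has_derivative D) (at p)" "inj D"
    by (auto simp: immersion_at_def)
  then have "linear D"
    using has_derivative_linear by blast
  then have "D (axis i 1) \<noteq> 0"
    using D(2) linear_injective_0[of D] axis_eq_0_iff[of i "1::real"] by auto
  then show ?thesis
    using has_derivative_partial[OF D(1)] by simp
qed

section \<open>Calculus with explicit vectors of length four\<close>

lemma vector_4 [simp]:
  "(vector [a, b, c, d] :: 'a::zero^4) $ 1 = a"
  "(vector [a, b, c, d] :: 'a::zero^4) $ 2 = b"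
  "(vector [a, b, c, d] :: 'a::zero^4) $ 3 = c"
  "(vector [a, b, c, d] :: 'a::zero^4) $ 4 = d"
  unfolding vector_def by simp_all

text \<open>A combination of constant vectors is a form to which the standard derivative rules
  apply.\<close>

lemma vector_4_sum_axis:
  "vector [a, b, c, d] =
    a *\<^sub>R axis 1 1 + b *\<^sub>R axis 2 1 + c *\<^sub>R axis 3 1 + d *\<^sub>R (axis 4 1 :: real^4)"
  by (simp add: vec_eq_iff forall_4 axis_def)

lemma has_vector_derivative_vector_4:
  assumes "(a has_real_derivative a') (at t)" "(b has_real_derivative b') (at t)"
    "(c has_real_derivative c') (at t)" "(d has_real_derivative d') (at t)"
  shows "((\<lambda>t. vector [a t, b t, c t, d t] :: real^4) has_vector_derivative
    vector [a', b', c', d']) (at t)"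
  unfolding vector_4_sum_axis using assms
  by (auto intro!: derivative_eq_intros)

lemma inner_vector_4:
  "(vector [a, b, c, d] :: real^4) \<bullet> vector [a', b', c', d'] = a * a' + b * b' + c * c' + d * d'"
  by (simp add: inner_vec_def sum_4)

section \<open>Algebra of diagonal matrices; \<open>*\<close> on vectors is componentwise\<close>

lemma diag_matrix_mult: "diag_matrix a ** diag_matrix b = diag_matrix (a * b)"
proof -
  have "(\<Sum>k\<in>UNIV. (if i = k then a $ i else 0) * (if k = j then b $ k else 0)) =
      (\<Sum>k\<in>UNIV. if k = i then if i = j then a $ i * b $ i else 0 else 0)" for i j
    by (rule sum.cong) auto
  then show ?thesis
    by (simp add: diag_matrix_def matrix_matrix_mult_def vec_eq_iff)
qed

lemma matrix_inv_diag_matrix: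
  fixes d :: "real^'n"
  assumes "\<And>i. d $ i \<noteq> 0"
  shows "matrix_inv (diag_matrix d) = diag_matrix (\<chi> i. inverse (d $ i))"
proof -
  let ?A = "diag_matrix d" and ?B = "diag_matrix (\<chi> i. inverse (d $ i))"
  have AB: "?A ** ?B = mat 1 \<and> ?B ** ?A = mat 1"
    using assms by (simp_all add: diag_matrix_mult) (simp_all add: diag_matrix_def mat_def vec_eq_iff)
  \<comment> \<open>\<open>matrix_inv\<close> is a choice among two-sided inverses and
    \<open>?B\<close> shows that one exists. Whichever is chosen, associativity then forces it to
    equal \<open>?B\<close>.\<close>
  then have "matrix_inv ?A ** ?A = mat 1"
    unfolding matrix_inv_def by (rule someI2) simp
  then have "matrix_inv ?A ** (?A ** ?B) = ?B"
    by (simp add: matrix_mul_assoc)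
  then show ?thesis
    by (simp add: AB)
qed

lemma fourth_form_diag:
  fixes a b :: "real^'n"
  assumes "first_form X p = diag_matrix a" "second_form X N p = diag_matrix b"
    and "\<And>i. a $ i \<noteq> 0"
  shows "fourth_form X N p = diag_matrix (\<chi> i. (b $ i) ^ 3 / (a $ i)\<^sup>2)"
  using assms
  by (simp add: fourth_form_def third_form_def shape_operator_def matrix_inv_diag_matrix
      diag_matrix_mult)
    (simp add: diag_matrix_def vec_eq_iff field_simps power2_eq_square power3_eq_cube)

section \<open>First and second fundamental forms of the hypersurface\<close>

lemma partial_rot_hypersurface_1:
  assumes "f differentiable at (p $ 1)" "\<phi> differentiable at (p $ 1)"
  shows "partial 1 (rot_hypersurface f \<phi>) p = rot_hypersurface (deriv f) (deriv \<phi>) p"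
proof -
  \<comment> \<open>\<open>partial\<close> differentiates along the line at parameter 0, so
    derivatives at \<open>p $ 1\<close> are shifted there.\<close>
  have d: "((\<lambda>t. h (p $ 1 + t)) has_real_derivative deriv h (p $ 1)) (at 0)"
    if "h differentiable at (p $ 1)" for h :: "real \<Rightarrow> real"
    using that DERIV_shift[of h "deriv h (p $ 1)" 0 "p $ 1"]
    by (simp add: add.commute DERIV_deriv_iff_real_differentiable)
  show ?thesis
    unfolding rot_hypersurface_def Let_def
    using d[OF assms(1)] d[OF assms(2)]
    by (intro partial_eqI has_vector_derivative_vector_4)
       (auto simp: axis_def intro!: derivative_eq_intros)
qed

lemma partial_rot_hypersurface_2:
  "partial 2 (rot_hypersurface f \<phi>) p =
    vector [- f (p $ 1) * sin (p $ 2) * cos (p $ 3), f (p $ 1) * cos (p $ 2) * cos (p $ 3), 0, 0]"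
  unfolding rot_hypersurface_def Let_def
  by (intro partial_eqI has_vector_derivative_vector_4)
     (auto simp: axis_def intro!: derivative_eq_intros)

lemma partial_rot_hypersurface_3:
  "partial 3 (rot_hypersurface f \<phi>) p =
    vector [- f (p $ 1) * cos (p $ 2) * sin (p $ 3), - f (p $ 1) * sin (p $ 2) * sin (p $ 3),
      f (p $ 1) * cos (p $ 3), 0]"
  unfolding rot_hypersurface_def Let_def
  by (intro partial_eqI has_vector_derivative_vector_4)
     (auto simp: axis_def intro!: derivative_eq_intros)

lemma first_form_rot_hypersurface:
  assumes "f differentiable at u" "\<phi> differentiable at u"
  shows "first_form (rot_hypersurface f \<phi>) (vector [u, v, w]) =
    diag_matrix (vector [speed_sq f \<phi> u, (f u)\<^sup>2 * (cos w)\<^sup>2, (f u)\<^sup>2])"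
proof -
  let ?p = "vector [u, v, w] :: real^3"
  \<comment> \<open>Eliminates squared sines in the right-nested products that
    \<open>algebra_simps\<close> produces.\<close>
  have trig: "sin t * (sin t * y) = y - cos t * (cos t * y)" for t y :: real
    using sin_cos_squared_add[of t] by algebra
  have x1: "partial 1 (rot_hypersurface f \<phi>) ?p = rot_hypersurface (deriv f) (deriv \<phi>) ?p"
    using assms by (intro partial_rot_hypersurface_1) simp_all
  show ?thesis
    unfolding first_form_def diag_matrix_def
    by (simp add: vec_eq_iff forall_3 x1 partial_rot_hypersurface_2 partial_rot_hypersurface_3)
       (simp add: rot_hypersurface_def inner_vector_4 speed_sq_def power2_eq_square
        algebra_simps trig)
qed

text \<open>The off-diagonal entries vanish because x_uv and x_vw are multiples of (-sin v, cos v,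
  0, 0) and x_uw is a multiple of (-cos v sin w, -sin v sin w, cos w, 0), both orthogonal to the
  Gauss map.\<close>

lemma second_form_rot_hypersurface:
  assumes "open U" "u \<in> U"
    and f: "\<And>t. t \<in> U \<Longrightarrow> f differentiable at t" "deriv f differentiable at u"
    and \<phi>: "\<And>t. t \<in> U \<Longrightarrow> \<phi> differentiable at t" "deriv \<phi> differentiable at u"
  shows "second_form (rot_hypersurface f \<phi>) (gauss_map f \<phi>) (vector [u, v, w]) =
    diag_matrix (speed_sq f \<phi> u powr (-1/2) *\<^sub>R vector
      [deriv (deriv f) u * deriv \<phi> u - deriv f u * deriv (deriv \<phi>) u,
       - (f u * deriv \<phi> u * (cos w)\<^sup>2), - (f u * deriv \<phi> u)])"
proof -
  let ?X = "rot_hypersurface f \<phi>" and ?p = "vector [u, v, w] :: real^3"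
  have trig: "sin t * (sin t * y) = y - cos t * (cos t * y)" for t y :: real
    using sin_cos_squared_add[of t] by algebra
  \<comment> \<open>The formula for x_u is available where f and \<phi> are differentiable; the
    cylinder over \<open>U\<close> is an open neighbourhood of \<open>?p\<close> on which this
    holds.\<close>
  have "open {q :: real^3. q $ 1 \<in> U}"
    using open_vimage[OF assms(1), of "\<lambda>q :: real^3. q $ 1"]
    by (simp add: vimage_def continuous_on_component)
  then have x1: "partial i (partial 1 ?X) ?p =
      partial i (rot_hypersurface (deriv f) (deriv \<phi>)) ?p" for i
    using assms(2) f(1) \<phi>(1)
    by (intro partial_cong) (auto intro!: partial_rot_hypersurface_1)
  have x11: "partial 1 (partial 1 ?X) ?p =
      rot_hypersurface (deriv (deriv f)) (deriv (deriv \<phi>)) ?p"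
    using f(2) \<phi>(2) by (simp add: x1 partial_rot_hypersurface_1)
  have df: "((\<lambda>t. f (u + t)) has_real_derivative deriv f u) (at 0)"
    using f(1)[OF assms(2)] DERIV_shift[of f "deriv f u" 0 u]
    by (simp add: add.commute DERIV_deriv_iff_real_differentiable)
  have x21: "partial 1 (partial 2 ?X) ?p =
      vector [- deriv f u * sin v * cos w, deriv f u * cos v * cos w, 0, 0]"
    \<comment> \<open>The formula for x_v holds at every point, so it rewrites the inner partial as
      a function.\<close>
    unfolding partial_rot_hypersurface_2[abs_def] using df
    by (intro partial_eqI has_vector_derivative_vector_4)
       (auto simp: axis_def intro!: derivative_eq_intros)
  have x22: "partial 2 (partial 2 ?X) ?p =
      vector [- f u * cos v * cos w, - f u * sin v * cos w, 0, 0]"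
    unfolding partial_rot_hypersurface_2[abs_def]
    by (intro partial_eqI has_vector_derivative_vector_4)
       (auto simp: axis_def intro!: derivative_eq_intros)
  have x23: "partial 3 (partial 2 ?X) ?p =
      vector [f u * sin v * sin w, - f u * cos v * sin w, 0, 0]"
    unfolding partial_rot_hypersurface_2[abs_def]
    by (intro partial_eqI has_vector_derivative_vector_4)
       (auto simp: axis_def intro!: derivative_eq_intros)
  have x31: "partial 1 (partial 3 ?X) ?p =
      vector [- deriv f u * cos v * sin w, - deriv f u * sin v * sin w, deriv f u * cos w, 0]"
    unfolding partial_rot_hypersurface_3[abs_def] using df
    by (intro partial_eqI has_vector_derivative_vector_4)
       (auto simp: axis_def intro!: derivative_eq_intros)
  have x32: "partial 2 (partial 3 ?X) ?p =
      vector [f u * sin v * sin w, - f u * cos v * sin w, 0, 0]"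
    unfolding partial_rot_hypersurface_3[abs_def]
    by (intro partial_eqI has_vector_derivative_vector_4)
       (auto simp: axis_def intro!: derivative_eq_intros)
  have x33: "partial 3 (partial 3 ?X) ?p =
      vector [- f u * cos v * cos w, - f u * sin v * cos w, - f u * sin w, 0]"
    unfolding partial_rot_hypersurface_3[abs_def]
    by (intro partial_eqI has_vector_derivative_vector_4)
       (auto simp: axis_def intro!: derivative_eq_intros)
  show ?thesis
    unfolding second_form_def diag_matrix_def
    by (simp add: vec_eq_iff forall_3 x11 x1[of 2] x1[of 3] x21 x22 x23 x31 x32 x33
        partial_rot_hypersurface_2 partial_rot_hypersurface_3)
       (simp add: rot_hypersurface_def gauss_map_def inner_vector_4
        power2_eq_square algebra_simps trig)
qed

text \<open>IV is cubic in II, which carries the factor W^(-1/2) of the unit normal. The (1,1) entry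
  is also divided by W^2, from the two inverses of I, whence 7/2 = 3/2 + 2.\<close>

lemma powr_neg_half_cubed:
  fixes W :: real
  assumes "W > 0"
  shows "(W powr (-1/2)) ^ 3 = 1 / W powr (3/2)"
    and "(W powr (-1/2)) ^ 3 / W\<^sup>2 = 1 / W powr (7/2)"
proof -
  show *: "(W powr (-1/2)) ^ 3 = 1 / W powr (3/2)"
    using assms by (simp add: powr_power flip: powr_minus_divide)
  have "W powr (7/2) = W powr (3/2) * W powr 2"
    by (simp flip: powr_add)
  then show "(W powr (-1/2)) ^ 3 / W\<^sup>2 = 1 / W powr (7/2)"
    using assms unfolding * by (simp add: powr_numeral)
qed

theorem corollary9:
  fixes f \<phi> :: "real \<Rightarrow> real" and U :: "real set" and u v w :: real
  assumes "open U" and "smooth_on U f" and "smooth_on U \<phi>" and "u \<in> U"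
    and "immersion_at (rot_hypersurface f \<phi>) (vector [u, v, w])"
  shows "let f1 = deriv f u; f2 = deriv (deriv f) u;
             g1 = deriv \<phi> u; g2 = deriv (deriv \<phi>) u;
             W = speed_sq f \<phi> u
         in fourth_form (rot_hypersurface f \<phi>) (gauss_map f \<phi>) (vector [u, v, w]) =
            diag_matrix (vector
              [- ((f1 * g2 - f2 * g1) ^ 3 / W powr (7/2)),
               - (g1 ^ 3 / (f u * W powr (3/2))) * (cos w)\<^sup>2,
               - (g1 ^ 3 / (f u * W powr (3/2)))])"
proof -
  let ?X = "rot_hypersurface f \<phi>" and ?p = "vector [u, v, w] :: real^3"
  define W where "W = speed_sq f \<phi> u"
  have diff: "h differentiable at t" "deriv h differentiable at t"
    if "smooth_on U h" "t \<in> U" for h t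
    \<comment> \<open>The cases n = 0 and n = 1 supply exactly the two derivatives that II
      involves.\<close>
    using that(1)[unfolded smooth_on_def, rule_format, OF that(2), of 0]
      that(1)[unfolded smooth_on_def, rule_format, OF that(2), of 1] by simp_all
  note d = diff[OF assms(2)] diff[OF assms(3)]
  have nz: "partial i ?X ?p \<noteq> 0" for i
    using immersion_at_partial_nonzero[OF assms(5)] .
  \<comment> \<open>If both derivatives vanished, so would x_u.\<close>
  have "deriv f u \<noteq> 0 \<or> deriv \<phi> u \<noteq> 0"
    using nz[of 1] d(1,3)[OF assms(4)]
    by (auto simp: partial_rot_hypersurface_1 rot_hypersurface_def vec_eq_iff forall_4)
  then have W: "W > 0"
    by (simp add: W_def speed_sq_def sum_power2_gt_zero_iff)
  \<comment> \<open>x_v carries the factor f cos w, so its nonvanishing yields both claims.\<close>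
  have fc: "f u \<noteq> 0" "cos w \<noteq> 0"
    using nz[of 2] by (auto simp: partial_rot_hypersurface_2 vec_eq_iff forall_4)
  have I: "first_form ?X ?p = diag_matrix (vector [W, (f u)\<^sup>2 * (cos w)\<^sup>2, (f u)\<^sup>2])"
    unfolding W_def using d(1,3) assms(4) by (intro first_form_rot_hypersurface) auto
  have II: "second_form ?X (gauss_map f \<phi>) ?p = diag_matrix (W powr (-1/2) *\<^sub>R vector
      [deriv (deriv f) u * deriv \<phi> u - deriv f u * deriv (deriv \<phi>) u,
       - (f u * deriv \<phi> u * (cos w)\<^sup>2), - (f u * deriv \<phi> u)])"
    unfolding W_def using d assms(4) by (intro second_form_rot_hypersurface[OF assms(1)]) auto
  have nz_diag: "(vector [W, (f u)\<^sup>2 * (cos w)\<^sup>2, (f u)\<^sup>2] :: real^3) $ i \<noteq> 0" for i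
    using W fc exhaust_3[of i] by auto
  \<comment> \<open>The sign comes from the cube being odd: II contains f'' \<phi>' - f' \<phi>'',
    the target its negative.\<close>
  have e1: "(W powr (-1/2) * (deriv (deriv f) u * deriv \<phi> u - deriv f u * deriv (deriv \<phi>) u)) ^ 3 / W\<^sup>2
      = - ((deriv f u * deriv (deriv \<phi>) u - deriv (deriv f) u * deriv \<phi> u) ^ 3 / W powr (7/2))"
    (is "(_ * ?A) ^ 3 / _ = - (?B ^ 3 / _)")
  proof -
    have "?A ^ 3 = - (?B ^ 3)"
      by (simp add: power3_eq_cube algebra_simps)
    moreover have "(W powr (-1/2) * ?A) ^ 3 / W\<^sup>2 = ?A ^ 3 * ((W powr (-1/2)) ^ 3 / W\<^sup>2)"
      by (simp add: power_mult_distrib)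
    ultimately show ?thesis
      by (simp only: powr_neg_half_cubed(2)[OF W]) simp
  qed
  \<comment> \<open>Here f^3 cos^6 w over f^4 cos^4 w leaves cos^2 w / f.\<close>
  have e2: "(W powr (-1/2) * - (f u * deriv \<phi> u * (cos w)\<^sup>2)) ^ 3 / ((f u)\<^sup>2 * (cos w)\<^sup>2)\<^sup>2
      = - (deriv \<phi> u ^ 3 / (f u * W powr (3/2))) * (cos w)\<^sup>2"
    using fc unfolding power_mult_distrib powr_neg_half_cubed[OF W]
    by (simp add: divide_simps) (simp add: eval_nat_numeral mult_ac)
  have e3: "(W powr (-1/2) * - (f u * deriv \<phi> u)) ^ 3 / ((f u)\<^sup>2)\<^sup>2
      = - (deriv \<phi> u ^ 3 / (f u * W powr (3/2)))"
    using fc unfolding power_mult_distrib powr_neg_half_cubed[OF W]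
    by (simp add: divide_simps) (simp add: eval_nat_numeral mult_ac)
  show ?thesis
    unfolding Let_def W_def[symmetric] fourth_form_diag[OF I II nz_diag]
    by (rule arg_cong[of _ _ diag_matrix])
       (simp only: vec_eq_iff forall_3 vec_lambda_beta vector_3 vector_scaleR_component
          real_scaleR_def e1 e2 e3 simp_thms)
qed

end
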